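(* Let $n\geq 2$. There is a bijection between the set of core intervals in $\mathscr{D}_n$ and the set of pairs $([w,w'],i)$ where $[w,w']$ is an arbitrary interval in $\mathscr{D}_{n-2}$ and $i$ is an integer between $0$ and the number of blocks of $w$ (both included). The core interval corresponding to $([w,w'],i)$ is $[e_i(w),(1,w',1,0,0)]$.
   Context: A Dyck path of size $n\geq 0$ is a word of length $2n$ in the letters $0,1$ with $n$ letters $1$ and $n$ letters $0$ such that every prefix contains at least as many $1$'s as $0$'s (the height after a prefix is its number of $1$'s minus its number of $0$'s). Let $\mathscr{D}_n$ be the set of Dyck paths of size $n$. Every Dyck path is uniquely a concatenation of blocks, a block being a non-empty Dyck path whose height is $0$ only at its two ends (the empty path has $0$ blocks). A subpath of a Dyck path $w$ is a non-empty sequence $x$ of consecutive letters of $w$ that starts and ends at the same height and stays strictly above that height in between. A subpath $x$ is movable in $w$ if it is immediately preceded in $w$ by the letter $0$ and either $x$ ends at the last letter of $w$ or $x$ is immediately followed in $w$ by the letter $1$. For a movable subpath $x$, let $N=N(w,x)\geq 1$ be the number of consecutive letters $0$ just before $x$, so $w=a\,0^{N}\,x\,b$ where $a$ does not end with $0$; for $1\leq i\leq N$ let $M(w,x,i)=a\,0^{N-i}\,x\,0^{i}\,b\in\mathscr{D}_n$. Let $\Gamma_n$ be the directed graph on $\mathscr{D}_n$ with edges $w\to M(w,x,i)$ for all movable $x$ in $w$ and all $1\leq i\leq N(w,x)$. The dexter order is: $u\leq v$ if and only if there is a directed path (possibly of length $0$) from $u$ to $v$ in $\Gamma_n$. This is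 a partial order whose cover relations are exactly the edges of $\Gamma_n$. An interval $[u,v]$ is given by a pair $u\leq v$. A core interval in $\mathscr{D}_n$ is an interval whose minimum has the shape $(v,1,0)$ and whose maximum has the shape $(1,w,1,0,0)$, where $v$ and $w$ are Dyck paths. For $w\in\mathscr{D}_{n-2}$ with blocks $w=w_1w_2\cdots w_{m}$ ($m\geq 0$) and $0\leq i\leq m$, set $e_i(w)=(1,w_1,\dots,w_i,0,w_{i+1},\dots,w_m,1,0)\in\mathscr{D}_n$. *)

theory Defs
  imports Main
begin

text \<open>Words in the letters $0,1$ are Boolean lists: True is the letter $1$, False is the letter $0$.\<close>

definition height :: "bool list \<Rightarrow> int" where
  "height w = int (count_list w True) - int (count_list w False)"

definition dyck :: "nat \<Rightarrow> bool list set" where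
  "dyck n = {w. length w = 2 * n \<and> count_list w True = n \<and> count_list w False = n \<and>
     (\<forall>k \<le> length w. count_list (take k w) False \<le> count_list (take k w) True)}"

definition is_dyck :: "bool list \<Rightarrow> bool" where
  "is_dyck w \<longleftrightarrow> (\<exists>n. w \<in> dyck n)"

definition is_block :: "bool list \<Rightarrow> bool" where
  "is_block b \<longleftrightarrow> is_dyck b \<and> b \<noteq> [] \<and>
     (\<forall>k \<le> length b. height (take k b) = 0 \<longrightarrow> k = 0 \<or> k = length b)"

text \<open>Every Dyck path has exactly one such decomposition; on other words the value is irrelevant.\<close>

definition blocks :: "bool list \<Rightarrow> bool list list" where
  "blocks w = (THE bs. concat bs = w \<and> (\<forall>b \<in> set bs. is_block b))"

text \<open>A subpath is an occurrence inside \<^term>\<open>w\<close>, so the part \<^term>\<open>p\<close> before it and the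
  part \<^term>\<open>s\<close> after it are recorded together with the word \<^term>\<open>x\<close> itself.\<close>

definition subpath :: "bool list \<Rightarrow> bool list \<Rightarrow> bool list \<Rightarrow> bool list \<Rightarrow> bool" where
  "subpath w p x s \<longleftrightarrow> w = p @ x @ s \<and> x \<noteq> [] \<and> height (p @ x) = height p \<and>
     (\<forall>k. 0 < k \<and> k < length x \<longrightarrow> height p < height (p @ take k x))"

definition movable :: "bool list \<Rightarrow> bool list \<Rightarrow> bool list \<Rightarrow> bool list \<Rightarrow> bool" where
  "movable w p x s \<longleftrightarrow> subpath w p x s \<and> p \<noteq> [] \<and> last p = False \<and> (s = [] \<or> hd s = True)"

definition zeros_before :: "bool list \<Rightarrow> nat" where
  "zeros_before p = length (takeWhile (\<lambda>c. c = False) (rev p))"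

text \<open>For $i \le N$ (with $N$ the value of \<^const>\<open>zeros_before\<close> at \<^term>\<open>p\<close>), the last $i$ letters of
  \<^term>\<open>p\<close> are all $0$, so this word is $a\,0^{N-i}\,x\,0^{i}\,s$, where $p = a\,0^N$.\<close>

definition move :: "bool list \<Rightarrow> bool list \<Rightarrow> bool list \<Rightarrow> nat \<Rightarrow> bool list" where
  "move p x s i = take (length p - i) p @ x @ replicate i False @ s"

definition dexter_graph :: "nat \<Rightarrow> (bool list \<times> bool list) set" where
  "dexter_graph n = {(w, w'). w \<in> dyck n \<and> w' \<in> dyck n \<and>
     (\<exists>p x s i. movable w p x s \<and> 1 \<le> i \<and> i \<le> zeros_before p \<and> w' = move p x s i)}"

definition dexter_le :: "nat \<Rightarrow> bool list \<Rightarrow> bool list \<Rightarrow> bool" where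
  "dexter_le n u v \<longleftrightarrow> u \<in> dyck n \<and> v \<in> dyck n \<and> (u, v) \<in> (dexter_graph n)\<^sup>*"

definition intervals :: "nat \<Rightarrow> (bool list \<times> bool list) set" where
  "intervals n = {(u, v). dexter_le n u v}"

definition core_max :: "bool list \<Rightarrow> bool list" where
  "core_max w = [True] @ w @ [True, False, False]"

definition core_intervals :: "nat \<Rightarrow> (bool list \<times> bool list) set" where
  "core_intervals n = {(u, u'). (u, u') \<in> intervals n \<and>
     (\<exists>v. is_dyck v \<and> u = v @ [True, False]) \<and> (\<exists>w. is_dyck w \<and> u' = core_max w)}"

definition core_min :: "nat \<Rightarrow> bool list \<Rightarrow> bool list" where
  "core_min i w =
     [True] @ concat (take i (blocks w)) @ [False] @ concat (drop i (blocks w)) @ [True, False]"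

end

theory Submission
  imports Defs
begin

text \<open>Cutting a non-empty Dyck path at its first return writes it uniquely as \<open>1A0B\<close>, so the minimum
  of a core interval is \<open>1A0B10\<close>, that is \<open>e_i(AB)\<close> with \<open>i\<close> the number of blocks of \<open>A\<close>.
  It remains to see that \<open>1A0B10 \<le> 1w'100\<close> iff \<open>AB \<le> w'\<close>. If \<open>AB \<le> w'\<close>, moving the blocks of \<open>B\<close>
  and the final peak leads to \<open>1AB100\<close>, and the moves from \<open>AB\<close> to \<open>w'\<close> remain possible inside.
  Conversely, follow a path backwards from \<open>1w'100\<close>: the last run of zeros can only grow along
  moves, and this forces every word on the path to be \<open>1w100\<close> or \<open>1A0B10\<close>. Deleting the first
  letter, its matching zero and the final peak turns each move into a move in
  size \<open>n - 2\<close> or into an equality.\<close>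

section \<open>Heights and the prefix condition\<close>

lemma height_simps [simp]:
  "height [] = 0"
  "height (c # w) = (if c then 1 else -1) + height w"
  "height (u @ v) = height u + height v"
  "height (replicate i False) = - int i"
proof -
  show "height (replicate i False) = - int i"
    by (induction i) (auto simp: height_def)
qed (auto simp: height_def)

text \<open>The starting height is a parameter so that the prefix condition splits over
  \<open>@\<close>: the second factor starts at the height reached by the first.\<close>

primrec nonneg_from :: "int \<Rightarrow> bool list \<Rightarrow> bool" where
  "nonneg_from h [] \<longleftrightarrow> 0 \<le> h"
| "nonneg_from h (c # w) \<longleftrightarrow> 0 \<le> h \<and> nonneg_from (h + (if c then 1 else -1)) w"

lemma nonneg_from_start: "nonneg_from h w \<Longrightarrow> 0 \<le> h"
  by (cases w) auto

lemma nonneg_from_negative [simp]: "h < 0 \<Longrightarrow> \<not> nonneg_from h w"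
  by (cases w) auto

lemma nonneg_from_append [simp]:
  "nonneg_from h (u @ v) \<longleftrightarrow> nonneg_from h u \<and> nonneg_from (h + height u) v"
  by (induction u arbitrary: h) (auto simp: add.assoc dest: nonneg_from_start)

lemma nonneg_from_end: "nonneg_from h w \<Longrightarrow> 0 \<le> h + height w"
  using nonneg_from_append[of h w "[]"] by simp

lemma nonneg_from_zeros [simp]: "nonneg_from h (replicate i False) \<longleftrightarrow> int i \<le> h"
  by (induction i arbitrary: h) auto

lemma nonneg_from_mono: "nonneg_from h w \<Longrightarrow> h \<le> h' \<Longrightarrow> nonneg_from h' w"
  by (induction w arbitrary: h h') (auto split: if_splits)

lemma nonneg_from_iff_take:
  "nonneg_from h w \<longleftrightarrow> (\<forall>k \<le> length w. 0 \<le> h + height (take k w))"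
proof (induction w arbitrary: h)
  case (Cons c w)
  show ?case
    unfolding nonneg_from.simps Cons.IH
    by (auto simp: All_less_Suc2 le_simps(2)[symmetric] less_Suc_eq_le[symmetric] add.assoc)
qed auto

lemma length_eq_counts: "length w = count_list w True + count_list w False"
  by (induction w) auto

lemma dyck_iff: "w \<in> dyck n \<longleftrightarrow> nonneg_from 0 w \<and> height w = 0 \<and> length w = 2 * n"
  using length_eq_counts[of w]
  by (auto simp: dyck_def nonneg_from_iff_take height_def)

text \<open>Height 0 means equally many letters of each kind, so the size can be read off as the
  number of letters 1.\<close>

lemma is_dyck_iff: "is_dyck w \<longleftrightarrow> nonneg_from 0 w \<and> height w = 0"
proof -
  have "\<exists>n. length w = 2 * n" if "height w = 0"
    using that length_eq_counts[of w] by (intro exI[of _ "count_list w True"]) (simp add: height_def)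
  then show ?thesis
    by (auto simp: is_dyck_def dyck_iff)
qed

lemma mem_dyck_iff: "w \<in> dyck n \<longleftrightarrow> is_dyck w \<and> length w = 2 * n"
  by (auto simp: dyck_iff is_dyck_iff)

lemma is_dyck_Nil [simp]: "is_dyck []"
  by (simp add: is_dyck_iff)

lemma is_dyck_append: "is_dyck u \<Longrightarrow> is_dyck v \<Longrightarrow> is_dyck (u @ v)"
  by (simp add: is_dyck_iff)

lemma nonneg_from_is_dyck: "is_dyck x \<Longrightarrow> nonneg_from h x \<longleftrightarrow> 0 \<le> h"
  using nonneg_from_mono[of 0 x h] by (auto simp: is_dyck_iff dest: nonneg_from_start)

section \<open>First-return decomposition\<close>

text \<open>By induction from the right: if appending a letter to a word with non-negative prefixes
  breaks the condition, the letter is 0 and the word before it has height 0, hence is Dyck.\<close>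

lemma nonneg_or_first_descent:
  "nonneg_from 0 w \<or> (\<exists>A B. w = A @ False # B \<and> is_dyck A)"
proof (induction w rule: rev_induct)
  case (snoc c w)
  then show ?case
    using nonneg_from_end[of 0 w] by (cases c) (fastforce simp: is_dyck_iff)+
qed simp

text \<open>What follows the initial 1 has height -1, so it must descend below 0; its first descent
  is the zero matching that 1.\<close>

lemma dyck_first_return:
  assumes "is_dyck w" "w \<noteq> []"
  obtains A B where "w = True # A @ False # B" "is_dyck A" "is_dyck B"
proof -
  obtain c u where w: "w = c # u" using assms(2) by (cases w) auto
  have c: "c" using assms(1) w by (cases c) (auto simp: is_dyck_iff dest: nonneg_from_start)
  have "height u = -1" using assms(1) w c by (simp add: is_dyck_iff)
  then have "\<not> nonneg_from 0 u" using nonneg_from_end[of 0 u] by auto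
  then obtain A B where u: "u = A @ False # B" and A: "is_dyck A"
    using nonneg_or_first_descent by blast
  have "is_dyck B" using assms(1) A w c u by (auto simp: is_dyck_iff)
  then show thesis using that w c u A by auto
qed

text \<open>If one of \<open>A\<close>, \<open>A'\<close> were a proper prefix of the other, the
  longer one would continue it by a 0 and reach height -1.\<close>

lemma first_return_unique:
  assumes "A @ False # B = A' @ False # B'" "is_dyck A" "is_dyck A'"
  shows "A = A' \<and> B = B'"
  using assms by (auto simp: append_eq_append_conv2 Cons_eq_append_conv append_eq_Cons_conv is_dyck_iff)

section \<open>Block decomposition\<close>

lemma is_block_positive:
  assumes "is_block (p @ s)" "p \<noteq> []" "s \<noteq> []"
  shows "0 < height p"
proof -
  have "height (take (length p) (p @ s)) \<noteq> 0"
    using assms unfolding is_block_def by (metis append_eq_conv_conj append_self_conv length_0_conv length_append le_add1 take_all_iff order_refl)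
  moreover have "0 \<le> height p"
    using assms(1) nonneg_from_end[of 0 p] by (auto simp: is_block_def is_dyck_iff)
  ultimately show ?thesis by simp
qed

text \<open>The first return of a block can only be its end, so nothing follows the matching zero.
  Conversely, strictly inside \<open>1A0\<close> the height is one more than that of a prefix of
  \<open>A\<close>, hence positive.\<close>

lemma is_block_iff_first_return: "is_block x \<longleftrightarrow> (\<exists>A. is_dyck A \<and> x = True # A @ [False])"
proof
  assume x: "is_block x"
  then have "is_dyck x" "x \<noteq> []" by (auto simp: is_block_def)
  then obtain A B where AB: "x = True # A @ False # B" "is_dyck A"
    by (rule dyck_first_return)
  have "B = []"
    using is_block_positive[of "True # A @ [False]" B] x AB by (auto simp: is_dyck_iff)
  then show "\<exists>A. is_dyck A \<and> x = True # A @ [False]" using AB by auto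
next
  assume "\<exists>A. is_dyck A \<and> x = True # A @ [False]"
  then obtain A where A: "is_dyck A" and x: "x = True # A @ [False]" by blast
  have "k = 0 \<or> k = length x" if k: "k \<le> length x" "height (take k x) = 0" for k
  proof (rule ccontr)
    assume "\<not> (k = 0 \<or> k = length x)"
    then obtain j where j: "k = Suc j" "j \<le> length A"
      using k x by (cases k) auto
    then have "0 \<le> height (take j A)" using A by (auto simp: is_dyck_iff nonneg_from_iff_take)
    then show False using j k x by simp
  qed
  moreover have "is_dyck x" using A x by (simp add: is_dyck_iff nonneg_from_is_dyck)
  ultimately show "is_block x" using x by (simp add: is_block_def)
qed

lemma is_block_is_dyck: "is_block x \<Longrightarrow> is_dyck x"
  by (simp add: is_block_def)

lemma is_dyck_concat: "\<forall>b \<in> set bs. is_block b \<Longrightarrow> is_dyck (concat bs)"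
  by (induction bs) (auto intro: is_dyck_append is_block_is_dyck)

text \<open>Both are prefixes of one word; if they differed, the longer block would have height 0 at
  an interior point.\<close>

lemma block_prefix_unique:
  assumes "b @ u = c @ v" "is_block b" "is_block c"
  shows "b = c"
proof -
  have "s = []" if "is_block (p @ s)" "is_block p" for p s
    using is_block_positive[OF that(1)] that(2) by (auto simp: is_block_def is_dyck_iff)
  then show ?thesis using assms by (auto simp: append_eq_append_conv2)
qed

lemma block_decomposition_unique:
  "concat bs = concat cs \<Longrightarrow> \<forall>b \<in> set bs. is_block b \<Longrightarrow> \<forall>b \<in> set cs. is_block b \<Longrightarrow> bs = cs"
proof (induction bs arbitrary: cs)
  case Nil
  then show ?case by (cases cs) (auto simp: is_block_def)
next
  case (Cons b bs)
  have "b \<noteq> []" using Cons.prems(2) by (simp add: is_block_def)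
  then obtain c cs' where cs: "cs = c # cs'" using Cons.prems(1) by (cases cs) auto
  have "b = c"
    using block_prefix_unique[of b "concat bs" c "concat cs'"] Cons.prems cs by simp
  moreover have "bs = cs'"
    using Cons.IH[of cs'] Cons.prems cs calculation by simp
  ultimately show ?case using cs by simp
qed

lemma block_decomposition_exists:
  "is_dyck w \<Longrightarrow> \<exists>bs. concat bs = w \<and> (\<forall>b \<in> set bs. is_block b)"
proof (induction w rule: length_induct)
  case (1 w)
  show ?case
  proof (cases "w = []")
    case False
    then obtain A B where w: "w = True # A @ False # B" and "is_dyck A" "is_dyck B"
      using dyck_first_return 1 by blast
    moreover have "length B < length w" using w by simp
    ultimately obtain bs where "concat bs = B" "\<forall>b \<in> set bs. is_block b" using 1 by blast
    moreover have "is_block (True # A @ [False])"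
      using \<open>is_dyck A\<close> by (auto simp: is_block_iff_first_return)
    ultimately show ?thesis
      using w by (intro exI[of _ "(True # A @ [False]) # bs"]) auto
  qed (auto intro: exI[of _ "[]"])
qed

lemma blocks_concat: "\<forall>b \<in> set bs. is_block b \<Longrightarrow> blocks (concat bs) = bs"
  unfolding blocks_def by (rule the_equality) (auto intro: block_decomposition_unique)

lemma blocks_props:
  assumes "is_dyck w"
  shows "concat (blocks w) = w" "\<forall>b \<in> set (blocks w). is_block b"
  using block_decomposition_exists[OF assms] blocks_concat by auto

lemma blocks_append: "is_dyck u \<Longrightarrow> is_dyck v \<Longrightarrow> blocks (u @ v) = blocks u @ blocks v"
  using blocks_concat[of "blocks u @ blocks v"] blocks_props[of u] blocks_props[of v] by auto

section \<open>Moves as rewriting of words\<close>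

text \<open>\<open>a\<close> may itself end with zeros, so every admissible number of zeros is
  covered without naming the maximal run. The size is left out, so that a move can be transported
  between sizes.\<close>

definition dexter_step :: "bool list \<Rightarrow> bool list \<Rightarrow> bool" where
  "dexter_step w w' \<longleftrightarrow> (\<exists>a x i s. w = a @ replicate i False @ x @ s \<and>
     w' = a @ x @ replicate i False @ s \<and> is_block x \<and> 1 \<le> i \<and> (s = [] \<or> hd s))"

lemma dexter_stepI:
  "is_block x \<Longrightarrow> 1 \<le> i \<Longrightarrow> s = [] \<or> hd s \<Longrightarrow>
   dexter_step (a @ replicate i False @ x @ s) (a @ x @ replicate i False @ s)"
  unfolding dexter_step_def by blast

text \<open>Heights inside \<open>x\<close> matter only relative to \<open>height p\<close>, so the
  prefix \<open>p\<close> drops out and a subpath is just an occurrence of a block.\<close>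

lemma subpath_iff: "subpath w p x s \<longleftrightarrow> w = p @ x @ s \<and> is_block x"
proof -
  have "is_block x" if x: "x \<noteq> []" "height x = 0" "\<forall>k. 0 < k \<and> k < length x \<longrightarrow> 0 < height (take k x)"
  proof -
    have "0 \<le> height (take k x)" if "k \<le> length x" for k
      using x that by (cases "k = 0 \<or> k = length x") (auto simp: less_imp_le)
    then show ?thesis
      using x by (fastforce simp: is_block_def is_dyck_iff nonneg_from_iff_take)
  qed
  moreover have "0 < height (take k x)" if "is_block x" "0 < k" "k < length x" for k
    using is_block_positive[of "take k x" "drop k x"] that by (cases "x = []") auto
  ultimately show ?thesis
    by (auto simp: subpath_def is_block_def is_dyck_iff)
qed

text \<open>Turns the bound on \<open>i\<close> into a factorisation of \<open>p\<close>, the form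
  used in \<open>dexter_step\<close>.\<close>

lemma zeros_before_ge_iff: "i \<le> zeros_before p \<longleftrightarrow> (\<exists>a. p = a @ replicate i False)"
proof
  assume i: "i \<le> zeros_before p"
  have "takeWhile (\<lambda>c. c = False) (rev p) = replicate (zeros_before p) False"
    unfolding zeros_before_def by (rule replicate_eqI) (auto dest: set_takeWhileD)
  then have "rev p = replicate (zeros_before p) False @ dropWhile (\<lambda>c. c = False) (rev p)"
    by (metis takeWhile_dropWhile_id)
  also have "replicate (zeros_before p) False = replicate i False @ replicate (zeros_before p - i) False"
    using i by (simp add: replicate_add[symmetric])
  finally have "p = rev (replicate (zeros_before p - i) False @ dropWhile (\<lambda>c. c = False) (rev p)) @ replicate i False"
    by (metis append.assoc rev_append rev_replicate rev_rev_ident)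
  then show "\<exists>a. p = a @ replicate i False" ..
next
  assume "\<exists>a. p = a @ replicate i False"
  then show "i \<le> zeros_before p"
    by (auto simp: zeros_before_def takeWhile_append)
qed

lemma dexter_graph_iff:
  "(w, w') \<in> dexter_graph n \<longleftrightarrow> w \<in> dyck n \<and> w' \<in> dyck n \<and> dexter_step w w'"
proof -
  have "(\<exists>p x s i. movable w p x s \<and> 1 \<le> i \<and> i \<le> zeros_before p \<and> w' = move p x s i) \<longleftrightarrow>
      dexter_step w w'" (is "?L \<longleftrightarrow> ?R")
  proof
    assume ?L
    then obtain p x s i where *: "movable w p x s" "1 \<le> i" "i \<le> zeros_before p" "w' = move p x s i"
      by blast
    then obtain a where "p = a @ replicate i False" by (auto simp: zeros_before_ge_iff)
    then show ?R using * dexter_stepI[of x i s a]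
      by (auto simp: movable_def subpath_iff move_def)
  next
    assume ?R
    then obtain a x i s where *: "w = a @ replicate i False @ x @ s"
      "w' = a @ x @ replicate i False @ s" "is_block x" "1 \<le> i" "s = [] \<or> hd s"
      unfolding dexter_step_def by blast
    then have "movable w (a @ replicate i False) x s" "w' = move (a @ replicate i False) x s i"
      by (auto simp: movable_def subpath_iff move_def)
    moreover have "i \<le> zeros_before (a @ replicate i False)"
      by (auto simp: zeros_before_ge_iff)
    ultimately show ?L using \<open>1 \<le> i\<close> by blast
  qed
  then show ?thesis by (simp add: dexter_graph_def)
qed

text \<open>After the move the height below the \<open>i\<close> zeros is
  \<open>height a - i\<close>, which is non-negative; this is the height at which \<open>x\<close>
  starts once it is moved back.\<close>

lemma is_dyck_move_back:
  assumes "is_dyck (a @ x @ replicate i False @ s)" "is_dyck x"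
  shows "is_dyck (a @ replicate i False @ x @ s)"
  using assms by (auto simp: is_dyck_iff nonneg_from_is_dyck dest: nonneg_from_start)

lemma dexter_step_source_dyck: "dexter_step w w' \<Longrightarrow> w' \<in> dyck n \<Longrightarrow> w \<in> dyck n"
  unfolding dexter_step_def mem_dyck_iff
  by (auto intro: is_dyck_move_back is_block_is_dyck)

section \<open>Paths leading up to \<open>core_max\<close>\<close>

lemma core_max_mem_dyck: "w \<in> dyck n \<Longrightarrow> core_max w \<in> dyck (n + 2)"
  using nonneg_from_is_dyck[of w 1] by (auto simp: core_max_def mem_dyck_iff is_dyck_iff)

text \<open>The appended \<open>[True, False, False]\<close> begins with 1, so a subpath that ended
  at the last letter is now followed by 1 and stays movable.\<close>

lemma dexter_graph_lift:
  assumes "(w, w') \<in> dexter_graph n"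
  shows "(core_max w, core_max w') \<in> dexter_graph (n + 2)"
proof -
  from assms have w: "w \<in> dyck n" "w' \<in> dyck n" and "dexter_step w w'"
    by (auto simp: dexter_graph_iff)
  then obtain a x i s where *: "w = a @ replicate i False @ x @ s"
    "w' = a @ x @ replicate i False @ s" "is_block x" "1 \<le> i" "s = [] \<or> hd s"
    unfolding dexter_step_def by blast
  have "hd (s @ [True, False, False])" using *(5) by (cases s) auto
  then have "dexter_step (core_max w) (core_max w')"
    using dexter_stepI[OF *(3,4), of "s @ [True, False, False]" "True # a"] *(1,2)
    by (simp add: core_max_def)
  then show ?thesis using w core_max_mem_dyck by (simp add: dexter_graph_iff)
qed

text \<open>The zero closing the first block passes to the right of the blocks in \<open>bs\<close>
  one at a time, then of the final peak; each move carries a single zero.\<close>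

lemma path_to_core_max:
  assumes "\<forall>b \<in> set bs. is_block b" "is_dyck A" "A @ concat bs \<in> dyck n"
  shows "(True # A @ False # concat bs @ [True, False], core_max (A @ concat bs)) \<in> (dexter_graph (n + 2))\<^sup>*"
  using assms
proof (induction bs arbitrary: A)
  case Nil
  have "is_block [True, False]" by (simp add: is_block_iff_first_return)
  then have "dexter_step (True # A @ [False, True, False]) (core_max A)"
    using dexter_stepI[of "[True, False]" 1 "[]" "True # A"] by (simp add: core_max_def)
  then have "(True # A @ [False, True, False], core_max A) \<in> dexter_graph (n + 2)"
    using Nil core_max_mem_dyck dexter_step_source_dyck by (auto simp: dexter_graph_iff)
  then show ?case by auto
next
  case (Cons b bs)
  let ?u = "True # A @ False # concat (b # bs) @ [True, False]"
  let ?v = "True # (A @ b) @ False # concat bs @ [True, False]"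
  have b: "is_block b" and Ab: "is_dyck (A @ b)" and bs: "is_dyck (concat bs)"
    using Cons.prems by (auto intro: is_dyck_append is_dyck_concat is_block_is_dyck)
  have "hd (concat bs @ [True, False])"
    using Cons.prems(1) by (cases bs) (auto simp: is_block_iff_first_return)
  then have "dexter_step ?u ?v"
    using dexter_stepI[OF b, of 1 "concat bs @ [True, False]" "True # A"] by simp
  moreover have "?v \<in> dyck (n + 2)"
    using Ab bs Cons.prems(3) nonneg_from_is_dyck[of A 1] nonneg_from_is_dyck[of b 1]
      is_block_is_dyck[OF b] Cons.prems(2)
    by (auto simp: mem_dyck_iff is_dyck_iff)
  ultimately have "(?u, ?v) \<in> dexter_graph (n + 2)"
    using dexter_step_source_dyck by (auto simp: dexter_graph_iff)
  moreover have "(?v, core_max (A @ concat (b # bs))) \<in> (dexter_graph (n + 2))\<^sup>*"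
    using Cons.IH[of "A @ b"] Cons.prems Ab by simp
  ultimately show ?case by (rule converse_rtrancl_into_rtrancl)
qed

section \<open>Predecessors of the words on a path\<close>

text \<open>The zero closing the first block of the target either lies outside the moved part, and
  the move happens within \<open>A\<close> or \<open>B\<close>, or is one of the moved zeros.
  Deleting it then leaves a move with one zero fewer, which is an equality if it was the only
  one.\<close>

lemma pred_first_return:
  assumes "dexter_step v (True # A @ False # B)" "is_dyck v" "is_dyck A" "is_dyck B"
  obtains A' B' where "v = True # A' @ False # B'" "is_dyck A'" "is_dyck B'"
    "dexter_step (A' @ B') (A @ B) \<or> A' @ B' = A @ B"
proof -
  obtain a x i s where v: "v = a @ replicate i False @ x @ s"
    and v': "True # A @ False # B = a @ x @ replicate i False @ s"
    and x: "is_block x" and i: "1 \<le> i" and s: "s = [] \<or> hd s"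
    using assms(1) unfolding dexter_step_def by blast
  have xd: "is_dyck x" using x by (rule is_block_is_dyck)
  obtain X where X: "x = True # X @ [False]" using x by (auto simp: is_block_iff_first_return)
  \<comment> \<open>Otherwise \<open>v\<close> would start with 0, as \<open>i\<close> is
    positive.\<close>
  have "a \<noteq> []"
    using assms(2) v i by (auto simp: is_dyck_iff)
  then obtain a' where a: "a = True # a'" using v' by (cases a) auto
  with v' have eq: "a' @ x @ replicate i False @ s = A @ False # B" by simp
  have s0: "\<not> (\<exists>t. s = False # t)" using s by auto
  \<comment> \<open>Locate the zero that closes the first block.\<close>
  consider (left) t where "s = t @ False # B" "A = a' @ x @ replicate i False @ t"
    | (zero) j k where "A = a' @ x @ replicate j False" "B = replicate k False @ s" "i = j + 1 + k"
    | (inside) p q where "A = a' @ p" "x = p @ False # q"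
    | (right) t where "a' = A @ False # t" "B = t @ x @ replicate i False @ s"
  proof -
    from eq consider (1) t where "a' = A @ t" "t @ x @ replicate i False @ s = False # B"
      | (2) p where "A = a' @ p" "x @ replicate i False @ s = p @ False # B"
      by (auto simp: append_eq_append_conv2)
    then show thesis
    proof cases
      case 1
      \<comment> \<open>If \<open>t\<close> were empty, \<open>x\<close> would start with 0.\<close>
      then show thesis using X right by (cases t) auto
    next
      case 2
      from 2(2) consider (3) q where "x = p @ q" "q @ replicate i False @ s = False # B"
        | (4) r where "p = x @ r" "replicate i False @ s = r @ False # B"
        by (auto simp: append_eq_append_conv2)
      then show thesis
      proof cases
        case 3
        show thesis
        proof (cases q)
          case Nil
          \<comment> \<open>Here \<open>A\<close> ends exactly with \<open>x\<close>, so the closing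
            zero is the first of the moved zeros.\<close>
          then show thesis using 2(1) 3 i zero[of 0 "i - 1"] by (cases i) auto
        next
          case (Cons c q')
          then show thesis using 2(1) 3 inside by auto
        qed
      next
        case 4
        from 4(2) consider (5) q where "replicate i False = r @ q" "q @ s = False # B"
          | (6) t where "r = replicate i False @ t" "s = t @ False # B"
          by (auto simp: append_eq_append_conv2)
        then show thesis
        proof cases
          case 5
          \<comment> \<open>The closing zero cannot be the first letter of \<open>s\<close>.\<close>
          then have "q \<noteq> []" using s0 by auto
          then obtain q' where q: "q = False # q'" using 5 by (cases q) auto
          then have "r = replicate (length r) False" "q' = replicate (length q') False"
            using 5(1) by (metis append_eq_append_conv length_append length_replicate replicate_add,
              metis append_eq_append_conv length_append length_replicate replicate_add list.size(4) replicate_Suc Suc_eq_plus1 list.inject)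
          moreover have "i = length r + 1 + length q'"
            using arg_cong[OF 5(1), of length] q by simp
          ultimately show thesis using zero[of "length r" "length q'"] 2(1) 4(1) 5(2) q by auto
        next
          case 6
          then show thesis using left 2(1) 4(1) by simp
        qed
      qed
    qed
  qed
  then show thesis
  proof cases
    case left
    \<comment> \<open>\<open>s\<close> is non-empty, so its first letter is 1; it differs from the
      closing zero and hence belongs to \<open>t\<close>.\<close>
    then have "t \<noteq> []" "hd t" using s by (cases t; auto)+
    have "is_dyck (a' @ replicate i False @ x @ t)" using is_dyck_move_back assms(3) xd left by simp
    moreover have "dexter_step ((a' @ replicate i False @ x @ t) @ B) (A @ B)"
      using dexter_stepI[OF x i, of "t @ B" a'] \<open>t \<noteq> []\<close> \<open>hd t\<close> left by simp
    ultimately show thesis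
      using that[of "a' @ replicate i False @ x @ t" B] v a left assms(4) by auto
  next
    case zero
    \<comment> \<open>A Dyck path does not start with 0, so the closing zero is the last of the
      moved zeros.\<close>
    have "k = 0" using assms(4) zero by (auto simp: is_dyck_iff)
    have "is_dyck (a' @ replicate j False)" "is_dyck (x @ s)"
      using assms(3,4) zero \<open>k = 0\<close> xd by (auto simp: is_dyck_iff nonneg_from_is_dyck)
    moreover have "dexter_step ((a' @ replicate j False) @ x @ s) (A @ B) \<or>
        (a' @ replicate j False) @ x @ s = A @ B"
      using dexter_stepI[OF x, of j s a'] s zero \<open>k = 0\<close> by (cases j) auto
    ultimately show thesis
      using that[of "a' @ replicate j False" "x @ s"] v a zero \<open>k = 0\<close>
      by (auto simp: replicate_app_Cons_same)
  next
    case inside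
    \<comment> \<open>This case is impossible: strictly inside the block \<open>x\<close> the height
      exceeds that after \<open>a'\<close>, whereas \<open>A = a' @ p\<close> has height 0.\<close>
    have "p \<noteq> []" using inside X by auto
    then have "0 < height p" using is_block_positive[of p "False # q"] x inside by simp
    moreover have "0 \<le> height a'" using nonneg_from_end[of 0 a'] assms(3) inside by (auto simp: is_dyck_iff)
    ultimately show thesis using assms(3) inside by (auto simp: is_dyck_iff)
  next
    case right
    have "is_dyck (t @ replicate i False @ x @ s)" using is_dyck_move_back assms(4) xd right by simp
    moreover have "dexter_step (A @ t @ replicate i False @ x @ s) (A @ B)"
      using dexter_stepI[OF x i s, of "A @ t"] right by simp
    ultimately show thesis
      using that[of A "t @ replicate i False @ x @ s"] v a right assms(3) by auto
  qed
qed

text \<open>The displayed 1 is the last one of the word, so a suffix starting with 1 starts there or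
  earlier.\<close>

lemma suffix_contains_last_peak:
  assumes "z @ True # replicate m False = y @ s" "s \<noteq> []" "hd s"
  obtains t where "s = t @ True # replicate m False" "z = y @ t"
proof -
  obtain s1 where s1: "s = True # s1" using assms(2,3) by (cases s) auto
  from assms(1) consider (1) t where "z = y @ t" "t @ True # replicate m False = s"
    | (2) t where "z @ t = y" "True # replicate m False = t @ s"
    by (auto simp: append_eq_append_conv2)
  then show thesis
  proof cases
    case 1
    then show thesis using that[of t] by simp
  next
    case 2
    show thesis
    proof (cases t)
      case Nil
      then show thesis using 2 that[of "[]"] by simp
    next
      case (Cons c t')
      then have "True \<in> set (replicate m False)" using 2 s1 by simp
      then show thesis by simp
    qed
  qed
qed

text \<open>If the move ends at the last letter, the two final zeros leave only
  \<open>x = [True, False]\<close> and \<open>i = 1\<close>. Otherwise \<open>s\<close> contains the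
  final \<open>[True, False, False]\<close> and the move takes place inside
  \<open>w'\<close>.\<close>

lemma pred_core_max:
  assumes "dexter_step u (core_max w')" "is_dyck w'"
  shows "u = True # w' @ [False, True, False] \<or>
    (\<exists>w. u = core_max w \<and> is_dyck w \<and> dexter_step w w')"
proof -
  obtain a x i s where u: "u = a @ replicate i False @ x @ s"
    and u': "True # w' @ [True, False, False] = a @ x @ replicate i False @ s"
    and x: "is_block x" and i: "1 \<le> i" and s: "s = [] \<or> hd s"
    using assms(1) unfolding dexter_step_def core_max_def by auto
  obtain X where X: "x = True # X @ [False]" "is_dyck X"
    using x by (auto simp: is_block_iff_first_return)
  show ?thesis
  proof (cases "s = []")
    case True
    \<comment> \<open>Reading from the right exposes the last run of zeros.\<close>
    have "rev (a @ x @ replicate i False) = False # False # True # rev (True # w')"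
      using u' True by (metis append.right_neutral append_Cons rev.simps(2) rev_append append.assoc append_Nil rev_singleton_conv rev_swap)
    then have *: "replicate i False @ False # rev X @ True # rev a = False # False # True # rev (True # w')"
      by (simp add: X)
    \<comment> \<open>The last run has exactly two zeros, and the final letter of \<open>x\<close>
      is one of them.\<close>
    then have "i = 1"
      using i by (cases i; cases "i - 1"; cases "i - 2") auto
    then have "rev X @ True # rev a = True # rev (True # w')" using * by simp
    \<comment> \<open>A non-empty \<open>X\<close> would end with the last 1 of the word, but a Dyck
      path cannot end with 1.\<close>
    moreover have "X = []"
    proof (rule ccontr)
      assume "X \<noteq> []"
      then obtain Y c where Y: "X = Y @ [c]" by (cases X rule: rev_cases) auto
      then have "c" using calculation by simp
      then show False using X(2) Y nonneg_from_end[of 0 Y] by (auto simp: is_dyck_iff)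
    qed
    ultimately have "rev a = rev (True # w')" by simp
    then have "a = True # w'" by (simp only: rev_is_rev_conv)
    then show ?thesis using u True \<open>i = 1\<close> X \<open>X = []\<close> by simp
  next
    case False
    from u' have "(True # w') @ True # replicate 2 False = (a @ x @ replicate i False) @ s"
      by (simp add: numeral_2_eq_2)
    then obtain t where t: "s = t @ [True, False, False]" "True # w' = a @ x @ replicate i False @ t"
      using suffix_contains_last_peak[of "True # w'" 2 "a @ x @ replicate i False" s] s False
      by (auto simp: numeral_2_eq_2)
    \<comment> \<open>With \<open>a\<close> empty, \<open>True # w'\<close> would be at height 0
      after \<open>x\<close>, but \<open>w'\<close> being Dyck keeps it at height at least 1 after
      its first letter.\<close>
    have "a \<noteq> []"
      using t(2) assms(2) X i by (auto simp: is_dyck_iff)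
    then obtain a' where a: "a = True # a'" using t(2) by (cases a) auto
    have w': "w' = a' @ x @ replicate i False @ t" using t a by simp
    have "t = [] \<or> hd t" using s t by (cases t) auto
    then have "dexter_step (a' @ replicate i False @ x @ t) w'"
      using dexter_stepI[OF x i] w' by simp
    moreover have "is_dyck (a' @ replicate i False @ x @ t)"
      using is_dyck_move_back assms(2) is_block_is_dyck[OF x] w' by simp
    moreover have "u = core_max (a' @ replicate i False @ x @ t)"
      using u a t by (simp add: core_max_def)
    ultimately show ?thesis by blast
  qed
qed

text \<open>The words on a path to \<open>1w'100\<close>, each with its image in size \<open>n - 2\<close>.\<close>

definition core_lift :: "bool list \<Rightarrow> bool list \<Rightarrow> bool" where
  "core_lift u w \<longleftrightarrow> is_dyck w \<and> (u = core_max w \<or>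
     (\<exists>A B. is_dyck A \<and> is_dyck B \<and> u = True # A @ False # B @ [True, False] \<and> w = A @ B))"

text \<open>The part after the moved subpath contains the final peak, so the peak can be removed
  from both words.\<close>

lemma pred_append_peak:
  assumes "dexter_step u (z @ [True, False])"
  obtains v where "u = v @ [True, False]" "dexter_step v z"
proof -
  obtain a x i s where u: "u = a @ replicate i False @ x @ s"
    and z: "z @ [True, False] = a @ x @ replicate i False @ s"
    and x: "is_block x" and i: "1 \<le> i" and s: "s = [] \<or> hd s"
    using assms(1) unfolding dexter_step_def by auto
  \<comment> \<open>Moving a final subpath would create at least two trailing zeros.\<close>
  have "s \<noteq> []"
  proof
    assume "s = []"
    moreover obtain X where "x = True # X @ [False]" using x by (auto simp: is_block_iff_first_return)
    moreover obtain j where "i = Suc j" using i by (cases i) auto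
    ultimately have "rev (z @ [True, False]) = replicate j False @ False # False # rev X @ True # rev a"
      using z by (simp add: replicate_app_Cons_same)
    then show False by (cases j; cases "j - 1") auto
  qed
  from z have "z @ True # replicate 1 False = (a @ x @ replicate i False) @ s" by simp
  then obtain t where t: "s = t @ [True, False]" "z = a @ x @ replicate i False @ t"
    using suffix_contains_last_peak[of z 1 "a @ x @ replicate i False" s] s \<open>s \<noteq> []\<close> by auto
  have "t = [] \<or> hd t" using s t by (cases t) auto
  then show thesis
    using that[of "a @ replicate i False @ x @ t"] dexter_stepI[OF x i] u t by simp
qed

text \<open>One backward step: \<open>pred_core_max\<close> treats \<open>1w'100\<close>; for
  \<open>1A0B10\<close> the final peak is stripped first and \<open>pred_first_return\<close>
  applies to the rest.\<close>

lemma core_lift_pred: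
  assumes "(u, u') \<in> dexter_graph (n + 2)" "core_lift u' w'"
  shows "\<exists>w. core_lift u w \<and> (w, w') \<in> (dexter_graph n)\<^sup>*"
proof -
  have u: "u \<in> dyck (n + 2)" and u': "u' \<in> dyck (n + 2)" and step: "dexter_step u u'"
    using assms(1) by (auto simp: dexter_graph_iff)
  have w': "w' \<in> dyck n"
    using assms(2) u' by (auto simp: core_lift_def core_max_def mem_dyck_iff)
  consider (max) "u' = core_max w'" "is_dyck w'"
    | (split) A B where "is_dyck A" "is_dyck B" "u' = (True # A @ False # B) @ [True, False]" "w' = A @ B"
    using assms(2) by (auto simp: core_lift_def)
  then show ?thesis
  proof cases
    case max
    then consider "u = True # w' @ [False, True, False]"
      | w where "u = core_max w" "is_dyck w" "dexter_step w w'"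
      using pred_core_max step by blast
    then show ?thesis
    proof cases
      case 1
      then have "core_lift u w'"
        \<comment> \<open>The word \<open>1w'010\<close> is the split form with
          \<open>A = w'\<close> and \<open>B\<close> empty.\<close>
        using max(2) unfolding core_lift_def by (intro conjI disjI2 exI[of _ w'] exI[of _ "[]"]) auto
      then show ?thesis by blast
    next
      case 2
      then have "(w, w') \<in> dexter_graph n"
        using w' dexter_step_source_dyck by (auto simp: dexter_graph_iff)
      then show ?thesis using 2 by (auto simp: core_lift_def)
    qed
  next
    case split
    then obtain v where v: "u = v @ [True, False]" "dexter_step v (True # A @ False # B)"
      using step pred_append_peak by blast
    have "is_dyck v" using u v(1) by (simp add: mem_dyck_iff is_dyck_iff)
    then obtain A' B' where *: "v = True # A' @ False # B'" "is_dyck A'" "is_dyck B'"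
      "dexter_step (A' @ B') w' \<or> A' @ B' = w'"
      using pred_first_return[OF v(2)] split by metis
    then have "core_lift u (A' @ B')"
      using v(1) is_dyck_append by (auto simp: core_lift_def)
    moreover have "(A' @ B', w') \<in> (dexter_graph n)\<^sup>*"
      using *(4) w' dexter_step_source_dyck by (auto simp: dexter_graph_iff)
    ultimately show ?thesis by blast
  qed
qed

lemma core_lift_path:
  assumes "(u, core_max w') \<in> (dexter_graph (n + 2))\<^sup>*" "is_dyck w'"
  shows "\<exists>w. core_lift u w \<and> (w, w') \<in> (dexter_graph n)\<^sup>*"
  using assms(1)
proof (induction rule: converse_rtrancl_induct)
  case base
  then show ?case using assms(2) by (auto simp: core_lift_def)
next
  case (step u v)
  then obtain w where "core_lift v w" "(w, w') \<in> (dexter_graph n)\<^sup>*" by blast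
  then show ?case using core_lift_pred[OF step(1)] by (meson rtrancl_trans)
qed

section \<open>Core intervals and the bijection\<close>

text \<open>Downwards, \<open>core_lift_path\<close> yields an image of the minimum, and by
  uniqueness of the first return this can only be \<open>A @ B\<close>. Upwards, the path goes
  through \<open>core_max (A @ B)\<close>.\<close>

lemma core_interval_iff:
  assumes "is_dyck A" "is_dyck B" "is_dyck w'"
  shows "(True # A @ False # B @ [True, False], core_max w') \<in> intervals (n + 2) \<longleftrightarrow>
    (A @ B, w') \<in> intervals n" (is "(?u, _) \<in> _ \<longleftrightarrow> _")
proof
  assume "(?u, core_max w') \<in> intervals (n + 2)"
  then have dyck: "?u \<in> dyck (n + 2)" "core_max w' \<in> dyck (n + 2)"
    and path: "(?u, core_max w') \<in> (dexter_graph (n + 2))\<^sup>*"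
    by (auto simp: intervals_def dexter_le_def)
  obtain w where w: "core_lift ?u w" "(w, w') \<in> (dexter_graph n)\<^sup>*"
    using core_lift_path[OF path assms(3)] by blast
  \<comment> \<open>The left word ends with 1, 0 and the right one with two zeros.\<close>
  have "?u \<noteq> core_max w"
    using arg_cong[of ?u "core_max w" rev] by (auto simp: core_max_def)
  then have "w = A @ B"
    using w(1) assms by (auto simp: core_lift_def dest!: first_return_unique)
  then show "(A @ B, w') \<in> intervals n"
    using w(2) dyck assms is_dyck_append
    by (auto simp: intervals_def dexter_le_def mem_dyck_iff core_max_def)
next
  assume "(A @ B, w') \<in> intervals n"
  then have dyck: "A @ B \<in> dyck n" "w' \<in> dyck n"
    and path: "(A @ B, w') \<in> (dexter_graph n)\<^sup>*"
    by (auto simp: intervals_def dexter_le_def)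
  have "(?u, core_max (A @ B)) \<in> (dexter_graph (n + 2))\<^sup>*"
    using path_to_core_max[of "blocks B" A n] blocks_props[OF assms(2)] assms dyck by simp
  also have "(core_max (A @ B), core_max w') \<in> (dexter_graph (n + 2))\<^sup>*"
    using path
  proof (induction rule: rtrancl_induct)
    case (step v w)
    then show ?case using dexter_graph_lift rtrancl_into_rtrancl by metis
  qed simp
  finally have "(?u, core_max w') \<in> (dexter_graph (n + 2))\<^sup>*" .
  moreover have "?u \<in> dyck (n + 2)"
    using dyck assms nonneg_from_is_dyck[of A 1] by (auto simp: mem_dyck_iff is_dyck_iff)
  ultimately show "(?u, core_max w') \<in> intervals (n + 2)"
    using core_max_mem_dyck[OF dyck(2)] by (simp add: intervals_def dexter_le_def)
qed

text \<open>The equation for \<open>blocks A\<close> is kept because it later recovers the index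
  \<open>i\<close>.\<close>

lemma core_min_split:
  assumes "is_dyck w"
  obtains A B where "core_min i w = True # A @ False # B @ [True, False]" "w = A @ B"
    "is_dyck A" "is_dyck B" "blocks A = take i (blocks w)"
proof -
  let ?A = "concat (take i (blocks w))" and ?B = "concat (drop i (blocks w))"
  have *: "\<forall>b \<in> set (take i (blocks w)). is_block b" "\<forall>b \<in> set (drop i (blocks w)). is_block b"
    using blocks_props(2)[OF assms] by (auto dest: in_set_takeD in_set_dropD)
  moreover have "w = ?A @ ?B"
    using blocks_props(1)[OF assms] by (metis append_take_drop_id concat_append)
  ultimately show thesis
    using that[of ?A ?B] is_dyck_concat blocks_concat by (simp add: core_min_def)
qed

text \<open>The first return determines both parts, hence \<open>w\<close>. The first part has
  exactly \<open>i\<close> blocks because \<open>i\<close> is at most the number of blocks of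
  \<open>w\<close>.\<close>

lemma core_min_inject:
  assumes "core_min i w = core_min j v" "is_dyck w" "is_dyck v"
    "i \<le> length (blocks w)" "j \<le> length (blocks v)"
  shows "i = j \<and> w = v"
proof -
  obtain A B where A: "core_min i w = True # A @ False # B @ [True, False]" "w = A @ B"
    "is_dyck A" "blocks A = take i (blocks w)" using core_min_split[OF assms(2)] by metis
  obtain C D where C: "core_min j v = True # C @ False # D @ [True, False]" "v = C @ D"
    "is_dyck C" "blocks C = take j (blocks v)" using core_min_split[OF assms(3)] by metis
  have "A = C \<and> B = D"
    using first_return_unique[of A "B @ [True, False]" C "D @ [True, False]"] assms(1) A C by simp
  then show ?thesis using A C assms(4,5) by (metis length_take min.absorb2)
qed

theorem mainTheorem8:
  fixes n :: nat
  assumes "n \<ge> 2"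
  shows "bij_betw (\<lambda>((w, w'), i). (core_min i w, core_max w'))
           {((w, w'), i). (w, w') \<in> intervals (n - 2) \<and> i \<le> length (blocks w)}
           (core_intervals n)"
proof -
  define m where "m = n - 2"
  then have n: "n = m + 2" using assms by simp
  let ?f = "\<lambda>((w, w'), i). (core_min i w, core_max w')"
  let ?S = "{((w, w'), i). (w, w') \<in> intervals m \<and> i \<le> length (blocks w)}"
  have interval_dyck: "is_dyck w \<and> is_dyck w'" if "(w, w') \<in> intervals m" for w w'
    using that by (auto simp: intervals_def dexter_le_def mem_dyck_iff)
  have "inj_on ?f ?S"
  proof (rule inj_onI, clarify)
    fix w w' i v v' j
    assume wi: "(w, w') \<in> intervals m" "i \<le> length (blocks w)"
      and vj: "(v, v') \<in> intervals m" "j \<le> length (blocks v)"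
      and eq: "core_min i w = core_min j v" "core_max w' = core_max v'"
    have "i = j \<and> w = v"
      using core_min_inject[OF eq(1)] interval_dyck wi vj by blast
    moreover have "w' = v'" using eq(2) by (simp add: core_max_def)
    ultimately show "((w, w') = (v, v')) \<and> i = j" by simp
  qed
  moreover have "?f p \<in> core_intervals n" if p: "p \<in> ?S" for p
  proof -
    obtain w w' i where w: "p = ((w, w'), i)" "(w, w') \<in> intervals m" using p by auto
    then have d: "is_dyck w" "is_dyck w'" using interval_dyck by auto
    obtain A B where AB: "core_min i w = True # A @ False # B @ [True, False]" "w = A @ B"
      "is_dyck A" "is_dyck B" using core_min_split[OF d(1)] by metis
    have "is_dyck (True # A @ False # B)"
      using AB nonneg_from_is_dyck[of A 1] by (simp add: is_dyck_iff)
    then have "\<exists>v. is_dyck v \<and> core_min i w = v @ [True, False]"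
      using AB(1) by (intro exI[of _ "True # A @ False # B"]) simp
    moreover have "(core_min i w, core_max w') \<in> intervals n"
      using core_interval_iff[OF AB(3,4) d(2)] AB w n by simp
    ultimately show ?thesis
      using w(1) d by (auto simp: core_intervals_def)
  qed
  moreover have "\<exists>p \<in> ?S. q = ?f p" if "q \<in> core_intervals n" for q
  proof -
    obtain v w' where q: "q = (v @ [True, False], core_max w')" "is_dyck v" "is_dyck w'"
      "(v @ [True, False], core_max w') \<in> intervals n"
      using \<open>q \<in> core_intervals n\<close> by (auto simp: core_intervals_def)
    \<comment> \<open>The single peak has size 1, whereas \<open>n\<close> is at least 2.\<close>
    have "v \<noteq> []"
    proof
      assume "v = []"
      then have "[True, False] \<in> dyck n" using q(4) by (simp add: intervals_def dexter_le_def)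
      then show False using n by (simp add: mem_dyck_iff)
    qed
    with q(2) obtain A B where v: "v = True # A @ False # B" "is_dyck A" "is_dyck B"
      by (rule dyck_first_return)
    have "(A @ B, w') \<in> intervals m"
      using core_interval_iff[OF v(2,3) q(3)] q(4) v(1) n by simp
    \<comment> \<open>The preimage index counts the blocks enclosed by the first return of
      \<open>v\<close>.\<close>
    moreover have "core_min (length (blocks A)) (A @ B) = v @ [True, False]"
      "length (blocks A) \<le> length (blocks (A @ B))"
      using v blocks_append[OF v(2,3)] blocks_props(1) by (auto simp: core_min_def)
    ultimately show ?thesis
      using q(1) by (intro bexI[of _ "((A @ B, w'), length (blocks A))"]) auto
  qed
  ultimately have "bij_betw ?f ?S (core_intervals n)"
    unfolding bij_betw_def by blast
  then show ?thesis using n by simp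
qed

end
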